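(* Let $\tau>0$, let $\beta>0$ be a real constant, let $V\in L^\infty(\mathcal D)$ with $V(x)\ge 0$ for all $x\in\mathcal D$, and let $\kappa\ge\|V\|_\infty+3\beta M^2$. Then the functional $\widetilde E^{1,\tau}$ is concave on the set $\{\phi\in L^2(\mathcal D):\|\phi\|_2\le1\}$.
   Context: $\mathcal D\subset\mathbb R^d$, $d\in\{1,2,3\}$, is a bounded domain (an interval for $d=1$, a rectangle for $d=2$, a box for $d=3$), with periodic boundary conditions imposed on all functions. Functions $\phi\in L^2(\mathcal D)$ are complex-valued, and $\|\cdot\|_2$, $\|\cdot\|_\infty$ are the norms of $L^2(\mathcal D)$, $L^\infty(\mathcal D)$. $e^{t\Delta}$, $t\ge 0$, denotes the heat semigroup on $L^2(\mathcal D)$ generated by the Laplacian with periodic boundary conditions. Let $$M=\sqrt{\frac{\beta+2\int_{\mathcal D}V(x)\,dx}{\beta|\mathcal D|}},$$ where $|\mathcal D|$ is the Lebesgue measure of $\mathcal D$. The truncated nonlinearity is $$\widetilde F(\phi)=\begin{cases}|\phi|^4,&|\phi|\le M,\\ 6M^2|\phi|^2-8M^3|\phi|+3M^4,&|\phi|>M,\end{cases}$$ and the truncated energy is $$\widetilde E^{1,\tau}(\phi)=\frac1{2\tau}+\int_{\mathcal D}\Big(-\frac1{2\tau}\big|e^{\frac\tau2\Delta}\phi\big|^2+V(x)|\phi|^2+\frac\beta2\widetilde F(\phi)-\kappa|\phi|^2\Big)\,dx+\kappa.$$ *)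

theory Defs
  imports
    "HOL-Analysis.Analysis"
    "HOL-Library.Function_Algebras"
    "HOL-Probability.Essential_Supremum"
begin

text \<open>The pointwise vector space structure on functions, so that the library's
  \<^const>\<open>concave_on\<close> applies to functionals.\<close>

instantiation "fun" :: (type, real_vector) real_vector
begin

definition scaleR_fun :: "real \<Rightarrow> ('a \<Rightarrow> 'b) \<Rightarrow> 'a \<Rightarrow> 'b"
  where "scaleR_fun c f = (\<lambda>x. c *\<^sub>R f x)"

instance
  by standard (auto simp: scaleR_fun_def fun_eq_iff algebra_simps)

end

section \<open>Lebesgue spaces on a domain\<close>

text \<open>Elements of the Lebesgue spaces are represented by functions on the whole space; only their
  values on the domain matter, and equality of classes is equality almost everywhere on it.\<close>

definition L2 :: "(real^'n) set \<Rightarrow> (real^'n \<Rightarrow> complex) set"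
  where "L2 D = {f \<in> borel_measurable (lebesgue_on D).
                  integrable (lebesgue_on D) (\<lambda>x. (cmod (f x))\<^sup>2)}"

definition L2_norm :: "(real^'n) set \<Rightarrow> (real^'n \<Rightarrow> complex) \<Rightarrow> real"
  where "L2_norm D f = sqrt (LINT x|lebesgue_on D. (cmod (f x))\<^sup>2)"

definition Linf :: "(real^'n) set \<Rightarrow> (real^'n \<Rightarrow> real) set"
  where "Linf D = {f \<in> borel_measurable (lebesgue_on D).
                    esssup (lebesgue_on D) (\<lambda>x. ereal \<bar>f x\<bar>) < \<infinity>}"

definition Linf_norm :: "(real^'n) set \<Rightarrow> (real^'n \<Rightarrow> real) \<Rightarrow> real"
  where "Linf_norm D f = real_of_ereal (esssup (lebesgue_on D) (\<lambda>x. ereal \<bar>f x\<bar>))"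

section \<open>The Laplacian with periodic boundary conditions\<close>

definition partial_deriv :: "'n \<Rightarrow> (real^'n \<Rightarrow> complex) \<Rightarrow> real^'n \<Rightarrow> complex"
  where "partial_deriv i f x = vector_derivative (\<lambda>h. f (x + h *\<^sub>R axis i 1)) (at 0)"

primrec C_k :: "nat \<Rightarrow> (real^'n \<Rightarrow> complex) \<Rightarrow> bool"
  where
    "C_k 0 f \<longleftrightarrow> continuous_on UNIV f"
  | "C_k (Suc k) f \<longleftrightarrow> continuous_on UNIV f \<and>
       (\<forall>i. (\<forall>x. (\<lambda>h::real. f (x + h *\<^sub>R axis i 1)) differentiable (at 0)) \<and>
            C_k k (partial_deriv i f))"

definition classical_laplacian :: "(real^'n \<Rightarrow> complex) \<Rightarrow> real^'n \<Rightarrow> complex"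
  where "classical_laplacian f x = (\<Sum>i\<in>UNIV. partial_deriv i (partial_deriv i f) x)"

definition periodic_smooth :: "real^'n \<Rightarrow> real^'n \<Rightarrow> (real^'n \<Rightarrow> complex) set"
  where "periodic_smooth a b =
    {\<psi>. (\<forall>k. C_k k \<psi>) \<and> (\<forall>i x. \<psi> (x + (b $ i - a $ i) *\<^sub>R axis i 1) = \<psi> x)}"

text \<open>The graph of the Laplacian on the periodic cell \<open>box a b\<close>, as an unbounded operator on
  \<open>L2 (box a b)\<close>: the Laplacian is taken in the sense of periodic distributions, and its domain
  consists of those square-integrable \<open>u\<close> for which it is again square-integrable, that is, of the
  periodic Sobolev space of order two. The boundary conditions are encoded by testing against
  periodic functions that need not vanish at the boundary.\<close>

definition periodic_laplacian ::
    "real^'n \<Rightarrow> real^'n \<Rightarrow> (real^'n \<Rightarrow> complex) \<Rightarrow> (real^'n \<Rightarrow> complex) \<Rightarrow> bool"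
  where "periodic_laplacian a b u f \<longleftrightarrow>
    u \<in> L2 (box a b) \<and> f \<in> L2 (box a b) \<and>
    (\<forall>\<psi>\<in>periodic_smooth a b.
       (LINT x|lebesgue_on (box a b). u x * classical_laplacian \<psi> x) =
       (LINT x|lebesgue_on (box a b). f x * \<psi> x))"

section \<open>The heat semigroup\<close>

definition bounded_L2_operator ::
    "(real^'n) set \<Rightarrow> ((real^'n \<Rightarrow> complex) \<Rightarrow> real^'n \<Rightarrow> complex) \<Rightarrow> bool"
  where "bounded_L2_operator D A \<longleftrightarrow>
    (\<forall>f\<in>L2 D. A f \<in> L2 D) \<and>
    (\<forall>f\<in>L2 D. \<forall>g\<in>L2 D. \<forall>c.
       AE x in lebesgue_on D. A (\<lambda>y. c * f y + g y) x = c * A f x + A g x) \<and>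
    (\<exists>C. \<forall>f\<in>L2 D. L2_norm D (A f) \<le> C * L2_norm D f)"

definition C0_semigroup ::
    "(real^'n) set \<Rightarrow> (real \<Rightarrow> (real^'n \<Rightarrow> complex) \<Rightarrow> real^'n \<Rightarrow> complex) \<Rightarrow> bool"
  where "C0_semigroup D T \<longleftrightarrow>
    (\<forall>t\<ge>0. bounded_L2_operator D (T t)) \<and>
    (\<forall>f\<in>L2 D. AE x in lebesgue_on D. T 0 f x = f x) \<and>
    (\<forall>s\<ge>0. \<forall>t\<ge>0. \<forall>f\<in>L2 D. AE x in lebesgue_on D. T (s + t) f x = T s (T t f) x) \<and>
    (\<forall>f\<in>L2 D. ((\<lambda>t. L2_norm D (\<lambda>x. T t f x - f x)) \<longlongrightarrow> 0) (at_right 0))"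

definition generator ::
    "(real^'n) set \<Rightarrow> (real \<Rightarrow> (real^'n \<Rightarrow> complex) \<Rightarrow> real^'n \<Rightarrow> complex) \<Rightarrow>
     (real^'n \<Rightarrow> complex) \<Rightarrow> (real^'n \<Rightarrow> complex) \<Rightarrow> bool"
  where "generator D T u f \<longleftrightarrow>
    u \<in> L2 D \<and> f \<in> L2 D \<and>
    ((\<lambda>t. L2_norm D (\<lambda>x. (T t u x - u x) / of_real t - f x)) \<longlongrightarrow> 0) (at_right 0)"

text \<open>Operators act on representatives, so \<open>T t\<close> is determined by this predicate up to equality
  almost everywhere: a strongly continuous semigroup is determined by its generator.\<close>

definition periodic_heat_semigroup ::
    "real^'n \<Rightarrow> real^'n \<Rightarrow> (real \<Rightarrow> (real^'n \<Rightarrow> complex) \<Rightarrow> real^'n \<Rightarrow> complex) \<Rightarrow> bool"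
  where "periodic_heat_semigroup a b T \<longleftrightarrow>
    C0_semigroup (box a b) T \<and> generator (box a b) T = periodic_laplacian a b"

section \<open>The truncated energy\<close>

definition trunc_level :: "(real^'n) set \<Rightarrow> (real^'n \<Rightarrow> real) \<Rightarrow> real \<Rightarrow> real"
  where "trunc_level D V \<beta> =
    sqrt ((\<beta> + 2 * (LINT x|lebesgue_on D. V x)) / (\<beta> * measure lebesgue D))"

definition F_trunc :: "real \<Rightarrow> complex \<Rightarrow> real"
  where "F_trunc M z =
    (if cmod z \<le> M then (cmod z)^4
     else 6 * M^2 * (cmod z)^2 - 8 * M^3 * cmod z + 3 * M^4)"

definition E_trunc ::
    "(real^'n) set \<Rightarrow> (real \<Rightarrow> (real^'n \<Rightarrow> complex) \<Rightarrow> real^'n \<Rightarrow> complex) \<Rightarrow>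
     (real^'n \<Rightarrow> real) \<Rightarrow> real \<Rightarrow> real \<Rightarrow> real \<Rightarrow> (real^'n \<Rightarrow> complex) \<Rightarrow> real"
  where "E_trunc D T V \<beta> \<kappa> \<tau> \<phi> =
    1 / (2 * \<tau>) +
    (LINT x|lebesgue_on D.
       - (1 / (2 * \<tau>)) * (cmod (T (\<tau> / 2) \<phi> x))\<^sup>2
       + V x * (cmod (\<phi> x))\<^sup>2
       + \<beta> / 2 * F_trunc (trunc_level D V \<beta>) (\<phi> x)
       - \<kappa> * (cmod (\<phi> x))\<^sup>2)
    + \<kappa>"

end

theory Submission
  imports Defs
begin

text \<open>
  The energy is the integral of a density that is concave pointwise. The heat semigroup acts
  linearly, so \<open>- \<bar>T \<phi>\<bar>\<^sup>2 / (2 \<tau>)\<close> is minus a positive semidefinite quadratic form in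
  \<open>\<phi>\<close>. The potential and interaction terms contribute minus the function
  \<open>(\<kappa> - V) \<bar>z\<bar>\<^sup>2 - (\<beta>/2) F(z)
     = (\<kappa> - V - 3 \<beta> M\<^sup>2) \<bar>z\<bar>\<^sup>2 + (\<beta>/2) (6 M\<^sup>2 \<bar>z\<bar>\<^sup>2 - F(z))\<close>
  at \<open>z = \<phi>(x)\<close>. The first summand is convex for almost every \<open>x\<close> because
  \<open>\<kappa> - 3 \<beta> M\<^sup>2\<close> dominates the essential supremum of \<open>V\<close>. The second is \<open>\<beta>/2\<close> times
  \<open>G(\<bar>z\<bar>)\<close>, where \<open>G(r) = 6 M\<^sup>2 r\<^sup>2 - r\<^sup>4\<close> up to \<open>r = M\<close>, and \<open>G\<close> continues beyond
  \<open>M\<close> along its tangent line at \<open>M\<close>. This \<open>G\<close> is convex and nondecreasing on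
  \<open>r \<ge> 0\<close>, so \<open>G(\<bar>z\<bar>)\<close> is convex in \<open>z\<close>: lemma \<open>convex_on_truncation_defect\<close>.

  Integration preserves the pointwise inequality, since every term of the density is bounded
  almost everywhere by a multiple of \<open>\<bar>\<phi>\<bar>\<^sup>2\<close> or of \<open>\<bar>T \<phi>\<bar>\<^sup>2\<close> and is therefore
  integrable for square-integrable \<open>\<phi>\<close>.
\<close>

section \<open>Convexity of the pointwise terms\<close>

lemma convex_on_norm_squared: "convex_on UNIV (\<lambda>z::'a::real_normed_vector. (norm z)\<^sup>2)"
proof (rule convex_onI)
  fix t :: real and x y :: 'a
  assume t: "0 < t" "t < 1"
  have "norm ((1 - t) *\<^sub>R x + t *\<^sub>R y) \<le> (1 - t) * norm x + t * norm y"
    using t norm_triangle_ineq[of "(1 - t) *\<^sub>R x" "t *\<^sub>R y"] by simp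
  then have "(norm ((1 - t) *\<^sub>R x + t *\<^sub>R y))\<^sup>2 \<le> ((1 - t) * norm x + t * norm y)\<^sup>2"
    by (simp add: power_mono)
  also have "\<dots> = (1 - t) * (norm x)\<^sup>2 + t * (norm y)\<^sup>2 - t * (1 - t) * (norm x - norm y)\<^sup>2"
    by (simp add: power2_eq_square algebra_simps)
  also have "\<dots> \<le> (1 - t) * (norm x)\<^sup>2 + t * (norm y)\<^sup>2"
    using t by simp
  finally show "(norm ((1 - t) *\<^sub>R x + t *\<^sub>R y))\<^sup>2 \<le> (1 - t) * (norm x)\<^sup>2 + t * (norm y)\<^sup>2" .
qed simp

text \<open>The left-hand side is the tangent line of \<open>r \<mapsto> 6 M\<^sup>2 r\<^sup>2 - r\<^sup>4\<close> at \<open>r = m\<close>,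
  evaluated at \<open>\<bar>z\<bar>\<close>. Supporting lines give convexity without differentiating the
  piecewise formula.\<close>

lemma tangent_le_truncation_defect:
  assumes "0 \<le> m" "m \<le> M"
  shows "(12 * M\<^sup>2 * m - 4 * m^3) * cmod z + (3 * m^4 - 6 * M\<^sup>2 * m\<^sup>2)
           \<le> 6 * M\<^sup>2 * (cmod z)\<^sup>2 - F_trunc M z"
proof -
  have quartic: "(12 * M\<^sup>2 * m - 4 * m^3) * s + (3 * m^4 - 6 * M\<^sup>2 * m\<^sup>2) \<le> 6 * M\<^sup>2 * s\<^sup>2 - s^4"
    if s: "0 \<le> s" "s \<le> M" for s :: real
  proof -
    have "s\<^sup>2 \<le> M\<^sup>2" "m\<^sup>2 \<le> M\<^sup>2" "m * s \<le> M\<^sup>2"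
      using s assms by (auto simp: power_mono power2_eq_square intro: mult_mono)
    then have "0 \<le> (s - m)\<^sup>2 * (6 * M\<^sup>2 - (s\<^sup>2 + 2 * (m * s) + 3 * m\<^sup>2))"
      by (intro mult_nonneg_nonneg) auto
    also have "\<dots> = 6 * M\<^sup>2 * s\<^sup>2 - s^4 - ((12 * M\<^sup>2 * m - 4 * m^3) * s + (3 * m^4 - 6 * M\<^sup>2 * m\<^sup>2))"
      by algebra
    finally show ?thesis by simp
  qed
  show ?thesis
  proof (cases "cmod z \<le> M")
    case True
    then show ?thesis
      using quartic[of "cmod z"] by (simp add: F_trunc_def)
  next
    case False
    \<comment> \<open>Beyond \<open>M\<close> both sides are affine in \<open>\<bar>z\<bar>\<close>: compare values at \<open>M\<close> and slopes.\<close>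
    have "0 \<le> 4 * (M - m)\<^sup>2 * (2 * M + m) * (cmod z - M)"
      using assms False by (intro mult_nonneg_nonneg) auto
    also have "\<dots> = (8 * M^3 - (12 * M\<^sup>2 * m - 4 * m^3)) * (cmod z - M)"
      by algebra
    finally have "(12 * M\<^sup>2 * m - 4 * m^3) * (cmod z - M) \<le> 8 * M^3 * (cmod z - M)"
      by (simp add: algebra_simps)
    moreover have "(12 * M\<^sup>2 * m - 4 * m^3) * M + (3 * m^4 - 6 * M\<^sup>2 * m\<^sup>2) \<le> 6 * M\<^sup>2 * M\<^sup>2 - M^4"
      using quartic[of M] assms by simp
    moreover have "6 * M\<^sup>2 * M\<^sup>2 - M^4 = 5 * M^4" "M^3 * M = M^4"
      by algebra+
    ultimately show ?thesis
      using False by (simp add: F_trunc_def algebra_simps)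
  qed
qed

lemma truncation_defect_eq_tangent:
  assumes "m = min (cmod z) M"
  shows "6 * M\<^sup>2 * (cmod z)\<^sup>2 - F_trunc M z
           = (12 * M\<^sup>2 * m - 4 * m^3) * cmod z + (3 * m^4 - 6 * M\<^sup>2 * m\<^sup>2)"
proof (cases "cmod z \<le> M")
  case True
  then have "m = cmod z" using assms by simp
  moreover have "6 * M\<^sup>2 * s\<^sup>2 - s^4 = (12 * M\<^sup>2 * s - 4 * s^3) * s + (3 * s^4 - 6 * M\<^sup>2 * s\<^sup>2)"
    for s :: real
    by algebra
  ultimately show ?thesis using True by (simp only: F_trunc_def if_True)
next
  case False
  then have "m = M" using assms by simp
  moreover have "6 * M\<^sup>2 * s\<^sup>2 - (6 * M\<^sup>2 * s\<^sup>2 - 8 * M^3 * s + 3 * M^4)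
      = (12 * M\<^sup>2 * M - 4 * M^3) * s + (3 * M^4 - 6 * M\<^sup>2 * M\<^sup>2)" for s :: real
    by algebra
  ultimately show ?thesis using False by (simp add: F_trunc_def)
qed

text \<open>A nondecreasing affine function of \<open>\<bar>z\<bar>\<close> is convex in \<open>z\<close>, and the defect is the
  pointwise maximum of the tangents at \<open>m \<in> [0, M]\<close>, whose slopes are nonnegative.\<close>

lemma convex_on_truncation_defect:
  assumes "0 \<le> M"
  shows "convex_on UNIV (\<lambda>z. 6 * M\<^sup>2 * (cmod z)\<^sup>2 - F_trunc M z)"
proof (rule convex_onI)
  fix t :: real and x y :: complex
  assume t: "0 < t" "t < 1"
  let ?G = "\<lambda>z. 6 * M\<^sup>2 * (cmod z)\<^sup>2 - F_trunc M z"
  let ?z = "(1 - t) *\<^sub>R x + t *\<^sub>R y"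
  define m where "m = min (cmod ?z) M"
  define p where "p = 12 * M\<^sup>2 * m - 4 * m^3"
  define q where "q = 3 * m^4 - 6 * M\<^sup>2 * m\<^sup>2"
  have m: "0 \<le> m" "m \<le> M" using assms by (auto simp: m_def)
  have "m\<^sup>2 \<le> M\<^sup>2" using m by (simp add: power_mono)
  then have "0 \<le> 3 * M\<^sup>2 - m\<^sup>2"
    using zero_le_power2[of M] by linarith
  then have "0 \<le> 4 * m * (3 * M\<^sup>2 - m\<^sup>2)"
    using m by simp
  also have "\<dots> = p" unfolding p_def by algebra
  finally have "0 \<le> p" .
  moreover have "cmod ?z \<le> (1 - t) * cmod x + t * cmod y"
    using t norm_triangle_ineq[of "(1 - t) *\<^sub>R x" "t *\<^sub>R y"] by simp
  ultimately have "p * cmod ?z + q \<le> p * ((1 - t) * cmod x + t * cmod y) + q"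
    by (simp add: mult_left_mono)
  also have "\<dots> = (1 - t) * (p * cmod x + q) + t * (p * cmod y + q)"
    by (simp add: algebra_simps)
  also have "\<dots> \<le> (1 - t) * ?G x + t * ?G y"
    using tangent_le_truncation_defect[OF m] t
    unfolding p_def q_def by (intro add_mono mult_left_mono) auto
  finally show "?G ?z \<le> (1 - t) * ?G x + t * ?G y"
    using truncation_defect_eq_tangent[OF m_def] by (simp add: p_def q_def)
qed simp

lemma convex_on_neg_local_density:
  assumes "0 \<le> M" "0 \<le> \<beta>" "v + 3 * \<beta> * M\<^sup>2 \<le> \<kappa>"
  shows "convex_on UNIV (\<lambda>z. \<kappa> * (cmod z)\<^sup>2 - v * (cmod z)\<^sup>2 - \<beta> / 2 * F_trunc M z)"
proof -
  have "convex_on UNIV (\<lambda>z. (\<kappa> - v - 3 * \<beta> * M\<^sup>2) * (cmod z)\<^sup>2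
          + \<beta> / 2 * (6 * M\<^sup>2 * (cmod z)\<^sup>2 - F_trunc M z))"
    using assms
    by (intro convex_on_add convex_on_cmul convex_on_norm_squared convex_on_truncation_defect) auto
  moreover have "(\<lambda>z. (\<kappa> - v - 3 * \<beta> * M\<^sup>2) * (cmod z)\<^sup>2
          + \<beta> / 2 * (6 * M\<^sup>2 * (cmod z)\<^sup>2 - F_trunc M z))
      = (\<lambda>z. \<kappa> * (cmod z)\<^sup>2 - v * (cmod z)\<^sup>2 - \<beta> / 2 * F_trunc M z)"
    by (rule ext) (simp add: algebra_simps)
  ultimately show ?thesis by simp
qed

section \<open>Integrability of the terms\<close>

lemma F_trunc_nonneg: "0 \<le> F_trunc M z"
proof -
  have "6 * M^2 * s^2 - 8 * M^3 * s + 3 * M^4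
      = M\<^sup>2 * (6 * (s - 2/3 * M)\<^sup>2 + 1/3 * M\<^sup>2)" for s :: real
    by algebra
  then show ?thesis by (auto simp: F_trunc_def)
qed

text \<open>The bound is the case \<open>m = 0\<close> of the tangent inequality.\<close>

lemma F_trunc_le: "0 \<le> M \<Longrightarrow> F_trunc M z \<le> 6 * M\<^sup>2 * (cmod z)\<^sup>2"
  using tangent_le_truncation_defect[of 0 M z] by simp

lemma borel_measurable_F_trunc [measurable]: "F_trunc M \<in> borel_measurable borel"
  unfolding F_trunc_def by measurable

lemma L2_cmult_add:
  assumes "f \<in> L2 D" "g \<in> L2 D"
  shows "(\<lambda>x. c * f x + g x) \<in> L2 D"
proof -
  have [measurable]: "f \<in> borel_measurable (lebesgue_on D)" "g \<in> borel_measurable (lebesgue_on D)"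
    and int: "integrable (lebesgue_on D) (\<lambda>x. (cmod (f x))\<^sup>2)"
      "integrable (lebesgue_on D) (\<lambda>x. (cmod (g x))\<^sup>2)"
    using assms by (auto simp: L2_def)
  have bound: "(cmod (c * u + v))\<^sup>2 \<le> 2 * (cmod c)\<^sup>2 * (cmod u)\<^sup>2 + 2 * (cmod v)\<^sup>2" for u v
  proof -
    have "(cmod (c * u + v))\<^sup>2 \<le> (cmod c * cmod u + cmod v)\<^sup>2"
      by (metis norm_mult norm_triangle_ineq norm_ge_zero power_mono)
    also have "\<dots> = 2 * (cmod c)\<^sup>2 * (cmod u)\<^sup>2 + 2 * (cmod v)\<^sup>2 - (cmod c * cmod u - cmod v)\<^sup>2"
      by (simp add: power2_eq_square algebra_simps)
    finally show ?thesis by (smt (verit) zero_le_power2)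
  qed
  have "integrable (lebesgue_on D) (\<lambda>x. (cmod (c * f x + g x))\<^sup>2)"
    by (rule Bochner_Integration.integrable_bound
        [of _ "\<lambda>x. 2 * (cmod c)\<^sup>2 * (cmod (f x))\<^sup>2 + 2 * (cmod (g x))\<^sup>2"])
      (use int bound in \<open>auto simp: abs_of_nonneg\<close>)
  then show ?thesis by (simp add: L2_def)
qed

lemma L2_line:
  assumes "f \<in> L2 D" "g \<in> L2 D"
  shows "(1 - t) *\<^sub>R f + t *\<^sub>R g \<in> L2 D"
proof -
  have "(\<lambda>x. of_real t * (- 1 * f x + g x) + f x) \<in> L2 D"
    using assms by (intro L2_cmult_add)
  also have "(\<lambda>x. of_real t * (- 1 * f x + g x) + f x) = (1 - t) *\<^sub>R f + t *\<^sub>R g"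
    by (rule ext) (simp add: scaleR_fun_def scaleR_conv_of_real algebra_simps)
  finally show ?thesis .
qed

lemma convex_L2_unit_ball:
  fixes D :: "(real^'n) set"
  shows "convex {f \<in> L2 D. L2_norm D f \<le> 1}"
proof (rule convexI)
  fix f g :: "real^'n \<Rightarrow> complex" and u v :: real
  assume f: "f \<in> {f \<in> L2 D. L2_norm D f \<le> 1}" and g: "g \<in> {f \<in> L2 D. L2_norm D f \<le> 1}"
    and uv: "0 \<le> u" "0 \<le> v" "u + v = 1"
  let ?h = "u *\<^sub>R f + v *\<^sub>R g" and ?I = "\<lambda>f. LINT x|lebesgue_on D. (cmod (f x))\<^sup>2"
  have u: "u = 1 - v" using uv by simp
  have h: "?h \<in> L2 D" using f g L2_line unfolding u by blast
  have "?I ?h \<le> (LINT x|lebesgue_on D. u * (cmod (f x))\<^sup>2 + v * (cmod (g x))\<^sup>2)"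
  proof (rule integral_mono)
    show "(cmod (?h x))\<^sup>2 \<le> u * (cmod (f x))\<^sup>2 + v * (cmod (g x))\<^sup>2" for x
      using convex_on_norm_squared uv by (auto simp: convex_on_def scaleR_fun_def)
  qed (use f g h in \<open>auto simp: L2_def\<close>)
  also have "\<dots> = u * ?I f + v * ?I g"
    using f g by (simp add: L2_def)
  also have "\<dots> \<le> 1"
    using f g uv by (intro convex_bound_le) (auto simp: L2_norm_def)
  finally show "?h \<in> {f \<in> L2 D. L2_norm D f \<le> 1}"
    using h by (simp add: L2_norm_def)
qed

text \<open>\<open>Linf_norm\<close> passes through \<open>real_of_ereal\<close>, which sends infinite values to \<open>0\<close>. The
  value \<open>\<infinity>\<close> is excluded by membership in \<open>Linf\<close>, and \<open>-\<infinity>\<close> is attained only on a null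
  domain, where the claim is vacuous.\<close>

lemma AE_abs_le_Linf_norm:
  assumes "V \<in> Linf D"
  shows "AE x in lebesgue_on D. \<bar>V x\<bar> \<le> Linf_norm D V"
proof -
  define S where "S = esssup (lebesgue_on D) (\<lambda>x. ereal \<bar>V x\<bar>)"
  have [measurable]: "V \<in> borel_measurable (lebesgue_on D)" and "S < \<infinity>"
    using assms by (auto simp: Linf_def S_def)
  have "AE x in lebesgue_on D. ereal \<bar>V x\<bar> \<le> S"
    unfolding S_def by (rule esssup_AE)
  then show ?thesis
    by eventually_elim (use \<open>S < \<infinity>\<close> in \<open>cases S; auto simp: Linf_norm_def simp flip: S_def\<close>)
qed

lemma integrable_energy_density:
  assumes V: "V \<in> Linf D" and M: "0 \<le> M" and f: "f \<in> L2 D" and g: "g \<in> L2 D"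
  shows "integrable (lebesgue_on D) (\<lambda>x. - c * (cmod (g x))\<^sup>2 + V x * (cmod (f x))\<^sup>2
           + \<beta> / 2 * F_trunc M (f x) - \<kappa> * (cmod (f x))\<^sup>2)"
proof -
  have [measurable]: "V \<in> borel_measurable (lebesgue_on D)" "f \<in> borel_measurable (lebesgue_on D)"
    and f2: "integrable (lebesgue_on D) (\<lambda>x. (cmod (f x))\<^sup>2)"
    and g2: "integrable (lebesgue_on D) (\<lambda>x. (cmod (g x))\<^sup>2)"
    using assms by (auto simp: L2_def Linf_def)
  have "AE x in lebesgue_on D.
          norm (V x * (cmod (f x))\<^sup>2) \<le> norm (Linf_norm D V * (cmod (f x))\<^sup>2)"
    using AE_abs_le_Linf_norm[OF V]
    by eventually_elim (auto simp: abs_mult intro!: mult_right_mono)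
  then have "integrable (lebesgue_on D) (\<lambda>x. V x * (cmod (f x))\<^sup>2)"
    using f2 by (intro Bochner_Integration.integrable_bound
        [of _ "\<lambda>x. Linf_norm D V * (cmod (f x))\<^sup>2" "\<lambda>x. V x * (cmod (f x))\<^sup>2"]) auto
  moreover have "integrable (lebesgue_on D) (\<lambda>x. F_trunc M (f x))"
    by (rule Bochner_Integration.integrable_bound[of _ "\<lambda>x. 6 * M\<^sup>2 * (cmod (f x))\<^sup>2"])
      (use f2 F_trunc_nonneg F_trunc_le[OF M] in \<open>auto simp: abs_of_nonneg\<close>)
  ultimately show ?thesis
    using f2 g2 by (intro Bochner_Integration.integrable_add Bochner_Integration.integrable_diff
        integrable_mult_right) auto
qed

section \<open>Concavity of the energy\<close>

text \<open>Linearity is only available in the form \<open>c f + g\<close>, so the segment is written as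
  \<open>f + t (g - f)\<close>.\<close>

lemma bounded_L2_operator_line:
  assumes A: "bounded_L2_operator D A" and f: "f \<in> L2 D" and g: "g \<in> L2 D"
  shows "AE x in lebesgue_on D. A ((1 - t) *\<^sub>R f + t *\<^sub>R g) x = (1 - t) *\<^sub>R A f x + t *\<^sub>R A g x"
proof -
  have lin: "AE x in lebesgue_on D. A (\<lambda>y. c * f y + g y) x = c * A f x + A g x"
    if "f \<in> L2 D" "g \<in> L2 D" for f g c
    using A that by (simp add: bounded_L2_operator_def)
  let ?d = "\<lambda>y. - 1 * f y + g y"
  have seg: "(1 - t) *\<^sub>R f + t *\<^sub>R g = (\<lambda>x. of_real t * ?d x + f x)"
    by (rule ext) (simp add: scaleR_fun_def scaleR_conv_of_real algebra_simps)
  show ?thesis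
    unfolding seg using lin[OF f g, of "- 1"] lin[OF L2_cmult_add[OF f g, of "- 1"] f, of "of_real t"]
  proof eventually_elim
    case (elim x)
    show ?case
      unfolding elim(2) elim(1) by (simp add: scaleR_conv_of_real algebra_simps)
  qed
qed

lemma trunc_level_nonneg:
  assumes "0 \<le> \<beta>" "\<And>x. x \<in> D \<Longrightarrow> 0 \<le> V x"
  shows "0 \<le> trunc_level D V \<beta>"
proof -
  have "0 \<le> (LINT x|lebesgue_on D. V x)"
    using assms(2) by (intro integral_nonneg_AE AE_I2) simp
  then show ?thesis
    using assms(1) by (simp add: trunc_level_def)
qed

theorem lemma2p6:
  fixes a b :: "real^'n" and V :: "real^'n \<Rightarrow> real" and \<tau> \<beta> \<kappa> :: real
    and T :: "real \<Rightarrow> (real^'n \<Rightarrow> complex) \<Rightarrow> real^'n \<Rightarrow> complex"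
  assumes "CARD('n) \<in> {1, 2, 3}"
    and "\<And>i. a $ i < b $ i"
    and "periodic_heat_semigroup a b T"
    and "\<tau> > 0" and "\<beta> > 0"
    and "V \<in> Linf (box a b)" and "\<And>x. x \<in> box a b \<Longrightarrow> V x \<ge> 0"
    and "\<kappa> \<ge> Linf_norm (box a b) V + 3 * \<beta> * (trunc_level (box a b) V \<beta>)\<^sup>2"
  shows "concave_on {\<phi> \<in> L2 (box a b). L2_norm (box a b) \<phi> \<le> 1}
           (E_trunc (box a b) T V \<beta> \<kappa> \<tau>)"
proof -
  define D where "D = box a b"
  define M where "M = trunc_level D V \<beta>"
  define A where "A = T (\<tau> / 2)"
  define c where "c = 1 / (2 * \<tau>)"
  have "0 \<le> c" using assms(4) by (simp add: c_def)
  define e where "e f x = - c * (cmod (A f x))\<^sup>2 + V x * (cmod (f x))\<^sup>2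
    + \<beta> / 2 * F_trunc M (f x) - \<kappa> * (cmod (f x))\<^sup>2" for f x
  have E: "E_trunc D T V \<beta> \<kappa> \<tau> f = c + (LINT x|lebesgue_on D. e f x) + \<kappa>" for f
    by (simp add: E_trunc_def e_def A_def M_def c_def)
  have A: "bounded_L2_operator D A"
    using assms(3,4) by (simp add: periodic_heat_semigroup_def C0_semigroup_def A_def D_def)
  then have A_L2: "A f \<in> L2 D" if "f \<in> L2 D" for f
    using that by (simp add: bounded_L2_operator_def)
  have M: "0 \<le> M"
    unfolding M_def using assms(5,7) by (intro trunc_level_nonneg) (auto simp: D_def)
  have V: "V \<in> Linf D" and \<kappa>: "Linf_norm D V + 3 * \<beta> * M\<^sup>2 \<le> \<kappa>"
    using assms(6,8) by (auto simp: D_def M_def)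
  have int: "integrable (lebesgue_on D) (e f)" if "f \<in> L2 D" for f
    unfolding e_def using integrable_energy_density[OF V M that A_L2[OF that]] .
  have "convex_on {\<phi> \<in> L2 D. L2_norm D \<phi> \<le> 1} (\<lambda>\<phi>. - E_trunc D T V \<beta> \<kappa> \<tau> \<phi>)"
  proof (rule convex_onI)
    fix t :: real and f g
    assume t: "0 < t" "t < 1"
      and "f \<in> {\<phi> \<in> L2 D. L2_norm D \<phi> \<le> 1}" "g \<in> {\<phi> \<in> L2 D. L2_norm D \<phi> \<le> 1}"
    then have f: "f \<in> L2 D" and g: "g \<in> L2 D" by auto
    let ?h = "(1 - t) *\<^sub>R f + t *\<^sub>R g"
    let ?I = "\<lambda>f. LINT x|lebesgue_on D. e f x"
    have "AE x in lebesgue_on D. (1 - t) * e f x + t * e g x \<le> e ?h x"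
      using AE_abs_le_Linf_norm[OF V] bounded_L2_operator_line[OF A f g, of t]
    proof eventually_elim
      case (elim x)
      let ?P = "\<lambda>z. \<kappa> * (cmod z)\<^sup>2 - V x * (cmod z)\<^sup>2 - \<beta> / 2 * F_trunc M z"
      have split: "e f x = - c * (cmod (A f x))\<^sup>2 - ?P (f x)" for f
        by (simp add: e_def)
      have "convex_on UNIV ?P"
        using elim(1) \<kappa> assms(5) by (intro convex_on_neg_local_density[OF M]) auto
      then have P: "?P (?h x) \<le> (1 - t) * ?P (f x) + t * ?P (g x)"
        using t unfolding convex_on_def plus_fun_apply scaleR_fun_def by simp
      have "(cmod (A ?h x))\<^sup>2 \<le> (1 - t) * (cmod (A f x))\<^sup>2 + t * (cmod (A g x))\<^sup>2"
        using convex_on_norm_squared[where 'a=complex] t unfolding elim(2) convex_on_def by simp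
      then have "c * (cmod (A ?h x))\<^sup>2
          \<le> c * ((1 - t) * (cmod (A f x))\<^sup>2 + t * (cmod (A g x))\<^sup>2)"
        using \<open>0 \<le> c\<close> by (rule mult_left_mono)
      moreover have "(1 - t) * (- c * u - p) + t * (- c * v - q)
          = - (c * ((1 - t) * u + t * v)) - ((1 - t) * p + t * q)" for u v p q :: real
        by (simp add: algebra_simps)
      ultimately show ?case
        using P unfolding split by simp
    qed
    then have "(LINT x|lebesgue_on D. (1 - t) * e f x + t * e g x) \<le> ?I ?h"
      using int[OF f] int[OF g] int[OF L2_line[OF f g]]
      by (intro integral_mono_AE) auto
    then have "(1 - t) * ?I f + t * ?I g \<le> ?I ?h"
      using int[OF f] int[OF g] by simp
    then show "- E_trunc D T V \<beta> \<kappa> \<tau> ?h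
        \<le> (1 - t) * - E_trunc D T V \<beta> \<kappa> \<tau> f + t * - E_trunc D T V \<beta> \<kappa> \<tau> g"
      unfolding E by (simp add: algebra_simps)
  qed (rule convex_L2_unit_ball)
  then show ?thesis
    by (simp add: concave_on_def D_def)
qed

end
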